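(* In the setting described in the context, let $\Xi\subset\mathbb{R}^L$ be $\mathrm{conv}(g(\mathcal{X}))$-maximal. Suppose there exists a feature map $\mathcal{A}:\mathcal{X}\to\mathbb{R}^L$ such that $\mathcal{A}(X)\in\mathcal{P}_\Xi(g(X))$ and $a=E[g(X)\mid\mathcal{A}(X)=a]$ for $\gamma$-almost every $(a,X)$, where $\gamma$ is the law of $(\mathcal{A}(X),X)$ with $X\sim p$. Then $\mathcal{A}$ is an optimal autoencoder.
   Context: Let $\mathcal{X}\subset\mathbb{R}^L$ be Borel, $p$ a probability measure on $\mathcal{X}$ with a Lebesgue density, $g:\mathcal{X}\to\mathbb{R}^L$ Borel and $W:\mathbb{R}^L\to\mathbb{R}$ of class $C^3$. An autoencoder is a Borel probability measure $\gamma$ on $\mathbb{R}^L\times\mathcal{X}$ with $\mathcal{X}$-marginal $p$ and $E_\gamma[g(X)\mid a]=a$ for $\gamma$-a.e. $a$; it is optimal if it maximizes $E_\gamma[W(a)]$ over all autoencoders. Define $c(a,b)=W(b)-W(a)+DW(a)(a-b)$ and $\mathcal{P}_\Xi(b)=\arg\min_{a\in\Xi}c(a,b)$. $\Xi$ is $Y$-maximal if $\inf_{a\in\Xi}c(a,b)\le0$ for all $b\in Y$. $\mathrm{conv}$ denotes convex hull. *)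

theory Defs
  imports "HOL-Analysis.Analysis" "HOL-Probability.Probability"
begin

definition C3 :: "('a::euclidean_space \<Rightarrow> real) \<Rightarrow> bool" where
  "C3 W \<longleftrightarrow> (\<exists>(D1 :: 'a \<Rightarrow> ('a \<Rightarrow>\<^sub>L real)) (D2 :: 'a \<Rightarrow> ('a \<Rightarrow>\<^sub>L ('a \<Rightarrow>\<^sub>L real)))
      (D3 :: 'a \<Rightarrow> ('a \<Rightarrow>\<^sub>L ('a \<Rightarrow>\<^sub>L ('a \<Rightarrow>\<^sub>L real)))).
      (\<forall>x. (W has_derivative blinfun_apply (D1 x)) (at x)) \<and>
      (\<forall>x. (D1 has_derivative blinfun_apply (D2 x)) (at x)) \<and>
      (\<forall>x. (D2 has_derivative blinfun_apply (D3 x)) (at x)) \<and>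
      continuous_on UNIV D3)"

definition cost :: "('a::euclidean_space \<Rightarrow> real) \<Rightarrow> 'a \<Rightarrow> 'a \<Rightarrow> real" where
  "cost W a b = W b - W a + frechet_derivative W (at a) (a - b)"

definition proj_set :: "('a::euclidean_space \<Rightarrow> real) \<Rightarrow> 'a set \<Rightarrow> 'a \<Rightarrow> 'a set" where
  "proj_set W \<Xi> b = {a \<in> \<Xi>. \<forall>a'\<in>\<Xi>. cost W a b \<le> cost W a' b}"

text \<open>Xi is Y-maximal: inf over Xi of c(a,b) <= 0 for every b in Y (inf taken in the
  extended reals, so the empty infimum is +infinity).\<close>
definition maximal :: "('a::euclidean_space \<Rightarrow> real) \<Rightarrow> 'a set \<Rightarrow> 'a set \<Rightarrow> bool" where
  "maximal W \<Xi> Y \<longleftrightarrow> (\<forall>b\<in>Y. (INF a\<in>\<Xi>. ereal (cost W a b)) \<le> 0)"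

text \<open>Autoencoder: Borel probability measure gamma on R^L x R^L (second factor the data
  space; it carries X since the second marginal is p, which is concentrated on X),
  with second marginal p, g(X) integrable, and E_gamma[g(X) | a] = a gamma-a.e.
  (componentwise conditional expectation w.r.t. the sigma algebra generated by a).\<close>
definition autoencoder ::
  "'a::euclidean_space measure \<Rightarrow> ('a \<Rightarrow> 'a) \<Rightarrow> ('a \<times> 'a) measure \<Rightarrow> bool" where
  "autoencoder p g \<gamma> \<longleftrightarrow>
     prob_space \<gamma> \<and> sets \<gamma> = sets (borel :: ('a \<times> 'a) measure) \<and>
     distr \<gamma> borel snd = p \<and>
     integrable \<gamma> (\<lambda>z. g (snd z)) \<and>
     (AE z in \<gamma>. \<forall>b\<in>Basis.
        real_cond_exp \<gamma> (vimage_algebra (space \<gamma>) fst borel) (\<lambda>z. g (snd z) \<bullet> b) z = fst z \<bullet> b)"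

text \<open>Optimal autoencoder: maximizes E_gamma[W(a)] over all autoencoders (objective
  finite for gamma; competitors with non-finite objective are excluded since the
  Bochner integral is not meaningful for them).\<close>
definition optimal_autoencoder ::
  "'a::euclidean_space measure \<Rightarrow> ('a \<Rightarrow> 'a) \<Rightarrow> ('a \<Rightarrow> real) \<Rightarrow> ('a \<times> 'a) measure \<Rightarrow> bool" where
  "optimal_autoencoder p g W \<gamma> \<longleftrightarrow>
     autoencoder p g \<gamma> \<and> integrable \<gamma> (\<lambda>z. W (fst z)) \<and>
     (\<forall>\<gamma>'. autoencoder p g \<gamma>' \<and> integrable \<gamma>' (\<lambda>z. W (fst z)) \<longrightarrow>
        (\<integral>z. W (fst z) \<partial>\<gamma>') \<le> (\<integral>z. W (fst z) \<partial>\<gamma>))"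

end

theory Submission
  imports Defs
begin

(*
  For every autoencoder the code a is the conditional mean of the data g(X) given a, so
  Jensen's inequality gives E phi(a) <= E phi(g(X)) for convex phi.  Take for phi the upper
  envelope of the tangent planes  l_xi(y) = W(xi) + DW(xi)(y - xi),  xi in Xi.  Maximality of
  Xi says W <= phi on conv g(X); this extends to the closure, which carries the law of every
  code, so E W(a) <= E phi(g(X)) for every autoencoder.  For the feature map A, A(X) is a
  projection of g(X), hence phi(g(X)) = l_A(X)(g(X)), and the mean of this tangent plane is
  E W(A(X)) because E[g(X) | A(X)] = A(X).  To keep everything measurable, phi is replaced
  by maxima of finitely many tangent planes at a dense sequence in Xi, and the limit is
  taken by dominated convergence.
*)

lemma le_of_segment_bound:
  fixes W :: "'a::real_normed_vector \<Rightarrow> real"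
  assumes cont: "isCont W y"
    and bound: "\<And>t. 0 < t \<Longrightarrow> t < 1 \<Longrightarrow> W ((1 - t) *\<^sub>R y + t *\<^sub>R x) \<le> (1 - t) * a + t * b"
  shows "W y \<le> a"
proof (rule tendsto_le[OF trivial_limit_at_right_real])
  have "((\<lambda>t. (1 - t) *\<^sub>R y + t *\<^sub>R x) \<longlongrightarrow> (1 - 0) *\<^sub>R y + 0 *\<^sub>R x) (at_right (0::real))"
    by (intro tendsto_intros)
  then show "((\<lambda>t. W ((1 - t) *\<^sub>R y + t *\<^sub>R x)) \<longlongrightarrow> W y) (at_right 0)"
    using isCont_tendsto_compose[OF cont] by simp
  have "((\<lambda>t. (1 - t) * a + t * b) \<longlongrightarrow> (1 - 0) * a + 0 * b) (at_right (0::real))"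
    by (intro tendsto_intros)
  then show "((\<lambda>t. (1 - t) * a + t * b) \<longlongrightarrow> a) (at_right 0)"
    by simp
  show "\<forall>\<^sub>F t in at_right 0. W ((1 - t) *\<^sub>R y + t *\<^sub>R x) \<le> (1 - t) * a + t * b"
    unfolding eventually_at_right_field by (intro exI[of _ 1]) (simp add: bound)
qed

lemma convex_bdd_above_affine_family:
  fixes l :: "'i \<Rightarrow> 'a::real_vector \<Rightarrow> real"
  assumes affine: "\<And>i x y t. l i ((1 - t) *\<^sub>R x + t *\<^sub>R y) = (1 - t) * l i x + t * l i y"
  shows "convex {z. bdd_above ((\<lambda>i. l i z) ` I)}"
proof (unfold convex_alt, intro ballI allI impI)
  fix x y and t :: real
  assume "x \<in> {z. bdd_above ((\<lambda>i. l i z) ` I)}" "y \<in> {z. bdd_above ((\<lambda>i. l i z) ` I)}"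
    and t: "0 \<le> t \<and> t \<le> 1"
  then obtain Bx By where "\<And>i. i \<in> I \<Longrightarrow> l i x \<le> Bx" "\<And>i. i \<in> I \<Longrightarrow> l i y \<le> By"
    by (auto simp: bdd_above_def)
  then have "l i ((1 - t) *\<^sub>R x + t *\<^sub>R y) \<le> (1 - t) * Bx + t * By" if "i \<in> I" for i
    unfolding affine using t that by (intro add_mono mult_left_mono) auto
  then have "bdd_above ((\<lambda>i. l i ((1 - t) *\<^sub>R x + t *\<^sub>R y)) ` I)"
    by (rule bdd_aboveI2)
  then show "(1 - t) *\<^sub>R x + t *\<^sub>R y \<in> {z. bdd_above ((\<lambda>i. l i z) ` I)}"
    by simp
qed

(* An upper envelope of affine functions stays below its chords, so W stays below the chord
  on the segment from a relative interior point to y; continuity of W at y closes the gap. *)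
lemma le_SUP_affine_family_closure:
  fixes l :: "'i \<Rightarrow> 'a::euclidean_space \<Rightarrow> real"
  assumes affine: "\<And>i x y t. l i ((1 - t) *\<^sub>R x + t *\<^sub>R y) = (1 - t) * l i x + t * l i y"
    and cont: "continuous_on UNIV W" and "I \<noteq> {}" and "convex C"
    and bdd: "\<And>z. z \<in> C \<Longrightarrow> bdd_above ((\<lambda>i. l i z) ` I)"
    and le: "\<And>z. z \<in> C \<Longrightarrow> W z \<le> (SUP i\<in>I. l i z)"
    and y: "y \<in> closure C" and bdd_y: "bdd_above ((\<lambda>i. l i y) ` I)"
  shows "W y \<le> (SUP i\<in>I. l i y)"
proof -
  have "C \<noteq> {}"
    using y by auto
  then obtain x where x: "x \<in> rel_interior C"
    using rel_interior_eq_empty[OF \<open>convex C\<close>] by auto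
  then have x_C: "x \<in> C"
    using rel_interior_subset by blast
  show ?thesis
  proof (rule le_of_segment_bound[where W = W and y = y and x = x])
    show "isCont W y"
      using cont by (simp add: continuous_on_eq_continuous_at)
    fix t :: real
    assume t: "0 < t" "t < 1"
    have "(1 - t) *\<^sub>R y + t *\<^sub>R x \<in> C"
    proof (cases "y = x")
      case False
      then have "(1 - t) *\<^sub>R y + t *\<^sub>R x \<in> open_segment x y"
        using t by (auto simp: in_segment intro!: exI[of _ "1 - t"] simp: algebra_simps)
      then show ?thesis
        using rel_interior_closure_convex_segment[OF \<open>convex C\<close> x y] rel_interior_subset by auto
    qed (use x_C in \<open>simp add: scaleR_left_diff_distrib\<close>)
    then have "W ((1 - t) *\<^sub>R y + t *\<^sub>R x) \<le> (SUP i\<in>I. l i ((1 - t) *\<^sub>R y + t *\<^sub>R x))"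
      by (rule le)
    also have "\<dots> \<le> (1 - t) * (SUP i\<in>I. l i y) + t * (SUP i\<in>I. l i x)"
      unfolding affine using \<open>I \<noteq> {}\<close> t bdd_y bdd[OF x_C]
      by (intro cSUP_least add_mono mult_left_mono cSUP_upper) auto
    finally show "W ((1 - t) *\<^sub>R y + t *\<^sub>R x) \<le> (1 - t) * (SUP i\<in>I. l i y) + t * (SUP i\<in>I. l i x)" .
  qed
qed

lemma le_sup_affine_family_closure_convex_hull:
  fixes l :: "'i \<Rightarrow> 'a::euclidean_space \<Rightarrow> real"
  assumes affine: "\<And>i x y t. l i ((1 - t) *\<^sub>R x + t *\<^sub>R y) = (1 - t) * l i x + t * l i y"
    and cont: "continuous_on UNIV W"
    and bdd: "\<And>s. s \<in> S \<Longrightarrow> bdd_above ((\<lambda>i. l i s) ` I)"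
    and hull: "\<And>z e. z \<in> convex hull S \<Longrightarrow> 0 < e \<Longrightarrow> \<exists>i\<in>I. W z - e < l i z"
    and y: "y \<in> closure (convex hull S)" and e: "0 < e"
  shows "\<exists>i\<in>I. W y - e < l i y"
proof (cases "bdd_above ((\<lambda>i. l i y) ` I)")
  case False
  then obtain i where "i \<in> I" "W y < l i y"
    by (auto simp: bdd_above_def not_le)
  then show ?thesis
    using e by force
next
  case True
  have "convex hull S \<subseteq> {z. bdd_above ((\<lambda>i. l i z) ` I)}"
    using bdd convex_bdd_above_affine_family[where l = l and I = I, OF affine]
    by (intro hull_minimal) auto
  then have hull_bdd: "bdd_above ((\<lambda>i. l i z) ` I)" if "z \<in> convex hull S" for z
    using that by auto
  have hull_le: "W z \<le> (SUP i\<in>I. l i z)" if z: "z \<in> convex hull S" for z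
  proof (rule ccontr)
    assume "\<not> W z \<le> (SUP i\<in>I. l i z)"
    then obtain i where "i \<in> I" "(SUP i\<in>I. l i z) < l i z"
      using hull[OF z, of "W z - (SUP i\<in>I. l i z)"] by auto
    then show False
      using cSUP_upper[OF _ hull_bdd[OF z]] by force
  qed
  have "I \<noteq> {}"
    using y hull[OF _ zero_less_one] closure_empty by force
  then have "W y \<le> (SUP i\<in>I. l i y)"
    using le_SUP_affine_family_closure[OF affine cont _ _ hull_bdd hull_le y True] by simp
  moreover obtain i where "i \<in> I" "(SUP i\<in>I. l i y) - e < l i y"
    using less_cSUP_iff[OF \<open>I \<noteq> {}\<close> True, of "(SUP i\<in>I. l i y) - e"] e by auto
  ultimately show ?thesis
    by force
qed

lemma dense_sequence_sup:
  fixes l :: "'a::{metric_space, second_countable_topology} \<Rightarrow> 'b \<Rightarrow> real"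
  assumes "I \<noteq> {}" and cont: "\<And>y. continuous_on UNIV (\<lambda>\<xi>. l \<xi> y)"
  obtains d :: "nat \<Rightarrow> 'a"
  where "range d \<subseteq> I" and "\<And>\<xi> y r. \<xi> \<in> I \<Longrightarrow> r < l \<xi> y \<Longrightarrow> \<exists>n. r < l (d n) y"
proof -
  obtain T where T: "countable T" "T \<subseteq> I" "I \<subseteq> closure T"
    by (rule separable)
  define d where "d = from_nat_into T"
  have range_d: "range d = T"
    unfolding d_def using T \<open>I \<noteq> {}\<close> by (intro range_from_nat_into) auto
  show ?thesis
  proof (rule that)
    show "range d \<subseteq> I"
      using range_d T(2) by simp
    fix \<xi> y r
    assume "\<xi> \<in> I" "r < l \<xi> y"
    moreover have "open {\<xi>. r < l \<xi> y}"
      using cont by (intro open_Collect_less) auto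
    ultimately have "{\<xi>. r < l \<xi> y} \<inter> T \<noteq> {}"
      using T(3) open_Int_closure_eq_empty by blast
    then show "\<exists>n. r < l (d n) y"
      unfolding range_d[symmetric] by auto
  qed
qed

primrec max_affine :: "(nat \<Rightarrow> real) \<Rightarrow> (nat \<Rightarrow> 'a::real_inner) \<Rightarrow> nat \<Rightarrow> 'a \<Rightarrow> real" where
  "max_affine c V 0 y = c 0 + V 0 \<bullet> y"
| "max_affine c V (Suc N) y = max (max_affine c V N y) (c (Suc N) + V (Suc N) \<bullet> y)"

lemma max_affine_ge: "n \<le> N \<Longrightarrow> c n + V n \<bullet> y \<le> max_affine c V N y"
  by (induction N) (auto simp: le_Suc_eq max.coboundedI1)

lemma max_affine_le: "(\<And>n. n \<le> N \<Longrightarrow> c n + V n \<bullet> y \<le> B) \<Longrightarrow> max_affine c V N y \<le> B"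
  by (induction N) auto

lemma borel_measurable_max_affine[measurable]:
  "max_affine c V N \<in> borel_measurable (borel :: 'a::{real_inner, second_countable_topology} measure)"
  by (induction N) simp_all

lemma integrable_max_affine:
  fixes f :: "'b \<Rightarrow> 'a::euclidean_space"
  assumes "finite_measure M" and "integrable M f"
  shows "integrable M (\<lambda>x. max_affine c V N (f x))"
proof -
  interpret finite_measure M by fact
  show ?thesis
    using assms(2) by (induction N) auto
qed

lemma max_affine_argmax:
  fixes V :: "nat \<Rightarrow> 'a::euclidean_space"
  obtains i :: "'a \<Rightarrow> nat"
  where "i \<in> borel \<rightarrow>\<^sub>M count_space UNIV"
    and "\<And>y. i y \<le> N" and "\<And>y. max_affine c V N y = c (i y) + V (i y) \<bullet> y"
proof (induction N arbitrary: thesis)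
  case 0
  show ?case
    by (rule 0[of "\<lambda>_. 0"]) auto
next
  case (Suc N)
  obtain i where [measurable]: "i \<in> borel \<rightarrow>\<^sub>M count_space UNIV"
    and i: "\<And>y. i y \<le> N" "\<And>y. max_affine c V N y = c (i y) + V (i y) \<bullet> y"
    using Suc.IH by blast
  define i' where
    "i' y = (if max_affine c V N y < c (Suc N) + V (Suc N) \<bullet> y then Suc N else i y)" for y
  show ?case
  proof (rule Suc.prems)
    show "i' \<in> borel \<rightarrow>\<^sub>M count_space UNIV"
      unfolding i'_def by measurable
  qed (use i in \<open>auto simp: i'_def le_SucI\<close>)
qed

lemma integral_le_of_AE_liminf_above:
  fixes f :: "'a \<Rightarrow> real" and u :: "nat \<Rightarrow> 'a \<Rightarrow> real"
  assumes f: "integrable M f" and u: "\<And>N. integrable M (u N)"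
    and u_ge: "\<And>N x. u 0 x \<le> u N x"
    and above: "AE x in M. \<forall>e>0. \<forall>\<^sub>F N in sequentially. f x - e < u N x"
    and bound: "\<And>N. integral\<^sup>L M (u N) \<le> B"
  shows "integral\<^sup>L M f \<le> B"
proof -
  define s where "s N x = min (f x) (u N x)" for N x
  have f_meas: "f \<in> borel_measurable M" and s_meas: "s N \<in> borel_measurable M" for N
    using f u unfolding s_def by auto
  have s_int: "integrable M (\<lambda>x. \<bar>f x\<bar> + \<bar>u 0 x\<bar>)"
    using f u by auto
  have "norm (s N x) \<le> \<bar>f x\<bar> + \<bar>u 0 x\<bar>" for N x
    using u_ge[of x N] unfolding s_def by (simp add: min_def) arith
  then have s_bound: "AE x in M. norm (s N x) \<le> \<bar>f x\<bar> + \<bar>u 0 x\<bar>" for N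
    by simp
  have s_lim: "AE x in M. (\<lambda>N. s N x) \<longlonglongrightarrow> f x"
    using above
  proof eventually_elim
    case (elim x)
    show ?case
    proof (rule order_tendstoI)
      fix a assume "a < f x"
      then have "\<forall>\<^sub>F N in sequentially. a < u N x"
        using elim[rule_format, of "f x - a"] by simp
      then show "\<forall>\<^sub>F N in sequentially. a < s N x"
        by eventually_elim (use \<open>a < f x\<close> in \<open>simp add: s_def\<close>)
    qed (simp add: s_def min_less_iff_disj)
  qed
  have "integrable M (s N)" for N
    by (rule integrable_dominated_convergence2[OF f_meas s_meas s_int s_lim s_bound])
  then have "integral\<^sup>L M (s N) \<le> integral\<^sup>L M (u N)" for N
    using u by (intro integral_mono) (auto simp: s_def)
  then have "integral\<^sup>L M (s N) \<le> B" for N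
    using bound order_trans by blast
  then show ?thesis
    using integral_dominated_convergence[OF f_meas s_meas s_int s_lim s_bound]
    by (intro LIMSEQ_le_const2) auto
qed

lemma integral_nonpos_of_truncations:
  fixes h r :: "'a \<Rightarrow> real"
  assumes h: "integrable M h" and [measurable]: "r \<in> borel_measurable M"
    and trunc: "\<And>n. (\<integral>z. (if r z \<le> real n then h z else 0) \<partial>M) \<le> 0"
  shows "integral\<^sup>L M h \<le> 0"
proof -
  have [measurable]: "h \<in> borel_measurable M"
    using h by auto
  define s where "s n z = (if r z \<le> real n then h z else 0)" for n :: nat and z
  have s_meas: "s n \<in> borel_measurable M" for n
    unfolding s_def by measurable
  have s_lim: "AE z in M. (\<lambda>n. s n z) \<longlonglongrightarrow> h z"
  proof (rule AE_I2, rule tendsto_eventually)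
    fix z
    show "\<forall>\<^sub>F n in sequentially. s n z = h z"
      unfolding eventually_sequentially s_def
      by (rule exI[of _ "nat \<lceil>r z\<rceil>"]) (auto intro: order.trans[OF real_nat_ceiling_ge])
  qed
  have s_bound: "AE z in M. norm (s n z) \<le> \<bar>h z\<bar>" for n
    unfolding s_def by auto
  have "(\<lambda>n. integral\<^sup>L M (s n)) \<longlonglongrightarrow> integral\<^sup>L M h"
    using integral_dominated_convergence[OF _ s_meas _ s_lim s_bound] h by auto
  then show ?thesis
    using trunc unfolding s_def by (intro LIMSEQ_le_const2) auto
qed

lemma
  assumes "sets M = sets (borel :: ('a::second_countable_topology \<times> 'b::second_countable_topology) measure)"
  shows measurable_fst_sets_borel: "fst \<in> borel_measurable M"
    and measurable_snd_sets_borel: "snd \<in> borel_measurable M"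
  using measurable_cong_sets[OF assms[folded borel_prod] refl] by auto

lemma finite_measure_subalgebra_vimage_algebra:
  assumes "finite_measure M" and "f \<in> M \<rightarrow>\<^sub>M N"
  shows "finite_measure_subalgebra M (vimage_algebra (space M) f N)"
proof -
  have "f \<in> space M \<rightarrow> space N"
    using assms(2) by (auto dest: measurable_space)
  then show ?thesis
    using assms
    by (auto simp: finite_measure_subalgebra_def finite_measure_subalgebra_axioms_def subalgebra_def
        sets_vimage_algebra2 measurable_sets)
qed

lemma integrable_inner_bounded_left:
  fixes f h :: "'b \<Rightarrow> 'a::euclidean_space"
  assumes "integrable M f" "h \<in> borel_measurable M" "\<And>x. norm (h x) \<le> K"
  shows "integrable M (\<lambda>x. h x \<bullet> f x)"
proof (rule Bochner_Integration.integrable_bound)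
  show "integrable M (\<lambda>x. K * norm (f x))"
    using assms(1) by auto
  show "AE x in M. norm (h x \<bullet> f x) \<le> norm (K * norm (f x))"
  proof (rule AE_I2)
    fix x
    have "norm (h x \<bullet> f x) \<le> norm (h x) * norm (f x)"
      by (simp add: Cauchy_Schwarz_ineq2)
    also have "\<dots> \<le> K * norm (f x)"
      using assms(3) by (simp add: mult_right_mono)
    finally show "norm (h x \<bullet> f x) \<le> norm (K * norm (f x))"
      by simp
  qed
qed (use assms in auto)

lemma measurable_graph:
  assumes "sets p = sets borel" and [measurable]: "A \<in> borel_measurable borel"
  shows "(\<lambda>x. (A x, x)) \<in> p \<rightarrow>\<^sub>M (borel :: ('a::second_countable_topology \<times> 'b::second_countable_topology) measure)"
proof -
  have "(\<lambda>x. (A x, x)) \<in> borel \<rightarrow>\<^sub>M (borel \<Otimes>\<^sub>M borel :: ('a \<times> 'b) measure)"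
    by measurable
  then show ?thesis
    by (simp add: borel_prod measurable_cong_sets[OF assms(1) refl])
qed

context
  fixes p :: "'a::euclidean_space measure" and g :: "'a \<Rightarrow> 'a" and M :: "('a \<times> 'a) measure"
  assumes autoencoder: "autoencoder p g M"
begin

lemma autoencoder_prob_space: "prob_space M"
  and autoencoder_sets: "sets M = sets borel"
  and autoencoder_distr_snd: "distr M borel snd = p"
  and autoencoder_integrable_data: "integrable M (\<lambda>z. g (snd z))"
  using autoencoder unfolding autoencoder_def by auto

lemmas autoencoder_measurable_fst[measurable] = measurable_fst_sets_borel[OF autoencoder_sets]
  and autoencoder_measurable_snd[measurable] = measurable_snd_sets_borel[OF autoencoder_sets]

lemma autoencoder_cond_exp:
  "AE z in M. \<forall>b\<in>Basis. real_cond_exp M (vimage_algebra (space M) fst borel)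
     (\<lambda>z. g (snd z) \<bullet> b) z = fst z \<bullet> b"
  using autoencoder unfolding autoencoder_def by auto

lemma autoencoder_integrable_code: "integrable M fst"
proof -
  interpret prob_space M by (rule autoencoder_prob_space)
  interpret finite_measure_subalgebra M "vimage_algebra (space M) fst borel"
    using autoencoder_sets
    by (intro finite_measure_subalgebra_vimage_algebra) (auto intro: finite_measure_axioms)
  have "integrable M (\<lambda>z. fst z \<bullet> b)" if "b \<in> Basis" for b
  proof (rule integrable_cong_AE_imp)
    show "integrable M (real_cond_exp M (vimage_algebra (space M) fst borel) (\<lambda>z. g (snd z) \<bullet> b))"
      using autoencoder_integrable_data by (intro real_cond_exp_int) auto
    show "AE z in M. real_cond_exp M (vimage_algebra (space M) fst borel) (\<lambda>z. g (snd z) \<bullet> b) z = fst z \<bullet> b"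
      using autoencoder_cond_exp that by auto
  qed (use autoencoder_sets in auto)
  then have "integrable M (\<lambda>z. \<Sum>b\<in>Basis. (fst z \<bullet> b) *\<^sub>R b)"
    by (intro Bochner_Integration.integrable_sum integrable_scaleR_left)
  then show ?thesis
    by (simp add: euclidean_representation)
qed

lemma autoencoder_integral_inner:
  assumes H: "H \<in> borel_measurable borel" "\<And>a. norm (H a) \<le> K"
  shows "(\<integral>z. H (fst z) \<bullet> g (snd z) \<partial>M) = (\<integral>z. H (fst z) \<bullet> fst z \<partial>M)"
proof -
  interpret prob_space M by (rule autoencoder_prob_space)
  define F where "F = vimage_algebra (space M) fst borel"
  interpret finite_measure_subalgebra M F
    unfolding F_def using autoencoder_sets
    by (intro finite_measure_subalgebra_vimage_algebra) (auto intro: finite_measure_axioms)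
  have g_meas[measurable]: "(\<lambda>z. g (snd z)) \<in> borel_measurable M"
    using autoencoder_integrable_data by auto
  have [measurable]: "H \<in> borel_measurable borel" by (rule H(1))
  have HF[measurable]: "(\<lambda>z. H (fst z) \<bullet> b) \<in> borel_measurable F" for b
  proof -
    have "fst \<in> F \<rightarrow>\<^sub>M borel"
      unfolding F_def by (rule measurable_vimage_algebra1) auto
    then show ?thesis by measurable
  qed
  have integrable_comp: "integrable M (\<lambda>z. (H (fst z) \<bullet> b) * (f z \<bullet> b))"
    if "integrable M f" for f :: "'a \<times> 'a \<Rightarrow> 'a" and b
    using integrable_inner_bounded_left[of M "\<lambda>z. (f z \<bullet> b) *\<^sub>R b" "\<lambda>z. H (fst z)" K] that H(2)
    by (simp add: mult.commute)
  have componentwise: "(\<integral>z. (H (fst z) \<bullet> b) * (g (snd z) \<bullet> b) \<partial>M)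
      = (\<integral>z. (H (fst z) \<bullet> b) * (fst z \<bullet> b) \<partial>M)" if "b \<in> Basis" for b
  proof -
    have "(\<integral>z. (H (fst z) \<bullet> b) * (g (snd z) \<bullet> b) \<partial>M)
        = (\<integral>z. (H (fst z) \<bullet> b) * real_cond_exp M F (\<lambda>z. g (snd z) \<bullet> b) z \<partial>M)"
      using real_cond_exp_intg(2)[OF integrable_comp[OF autoencoder_integrable_data] HF] by simp
    also have "\<dots> = (\<integral>z. (H (fst z) \<bullet> b) * (fst z \<bullet> b) \<partial>M)"
      using autoencoder_cond_exp that unfolding F_def[symmetric]
      by (intro integral_cong_AE) auto
    finally show ?thesis .
  qed
  have "(\<integral>z. H (fst z) \<bullet> g (snd z) \<partial>M) = (\<integral>z. (\<Sum>b\<in>Basis. (H (fst z) \<bullet> b) * (g (snd z) \<bullet> b)) \<partial>M)"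
    by (subst euclidean_inner) simp
  also have "\<dots> = (\<Sum>b\<in>Basis. (\<integral>z. (H (fst z) \<bullet> b) * (g (snd z) \<bullet> b) \<partial>M))"
    by (intro Bochner_Integration.integral_sum integrable_comp autoencoder_integrable_data)
  also have "\<dots> = (\<Sum>b\<in>Basis. (\<integral>z. (H (fst z) \<bullet> b) * (fst z \<bullet> b) \<partial>M))"
    using componentwise by simp
  also have "\<dots> = (\<integral>z. (\<Sum>b\<in>Basis. (H (fst z) \<bullet> b) * (fst z \<bullet> b)) \<partial>M)"
    by (intro Bochner_Integration.integral_sum[symmetric] integrable_comp autoencoder_integrable_code)
  also have "\<dots> = (\<integral>z. H (fst z) \<bullet> fst z \<partial>M)"
    by (subst (2) euclidean_inner) simp
  finally show ?thesis .
qed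

lemma autoencoder_AE_data:
  assumes "AE x in p. P x"
  shows "AE z in M. P (snd z)"
  using assms unfolding autoencoder_distr_snd[symmetric]
  by (rule AE_distrD[OF autoencoder_measurable_snd])

lemma autoencoder_integral_data:
  fixes f :: "'a \<Rightarrow> real"
  assumes "f \<in> borel_measurable borel"
  shows "(\<integral>z. f (snd z) \<partial>M) = (\<integral>x. f x \<partial>p)"
  using integral_distr[OF autoencoder_measurable_snd assms]
  by (simp add: autoencoder_distr_snd)

(* Test the self-consistency against the indicator of {a. t < a \<bullet> v}: on this event
  a \<bullet> v - g(X) \<bullet> v has mean zero but would be positive. *)
lemma autoencoder_AE_halfspace:
  assumes data: "AE x in p. g x \<bullet> v \<le> t"
  shows "AE z in M. fst z \<bullet> v \<le> t"
proof -
  interpret prob_space M by (rule autoencoder_prob_space)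
  have [measurable]: "(\<lambda>z. g (snd z)) \<in> borel_measurable M"
    using autoencoder_integrable_data by auto
  define S where "S = {a. t < a \<bullet> v}"
  have [measurable]: "S \<in> sets borel"
    unfolding S_def by measurable
  define H where "H a = indicator S a *\<^sub>R v" for a
  have H_meas[measurable]: "H \<in> borel_measurable borel"
    unfolding H_def by measurable
  have H_bound: "norm (H a) \<le> norm v" for a
    unfolding H_def by (simp add: indicator_def)
  have H_fst_meas: "(\<lambda>z. H (fst z)) \<in> borel_measurable M"
    by measurable
  have int_code: "integrable M (\<lambda>z. H (fst z) \<bullet> fst z)"
    and int_data: "integrable M (\<lambda>z. H (fst z) \<bullet> g (snd z))"
    using integrable_inner_bounded_left[OF autoencoder_integrable_code H_fst_meas H_bound]
      integrable_inner_bounded_left[OF autoencoder_integrable_data H_fst_meas H_bound] .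
  define f where "f z = H (fst z) \<bullet> fst z - H (fst z) \<bullet> g (snd z)" for z
  have "integrable M f"
    unfolding f_def using int_code int_data by auto
  moreover have "integral\<^sup>L M f = 0"
    unfolding f_def Bochner_Integration.integral_diff[OF int_code int_data]
    using autoencoder_integral_inner[OF H_meas H_bound] by simp
  moreover have data_M: "AE z in M. g (snd z) \<bullet> v \<le> t"
    by (rule autoencoder_AE_data[OF data])
  then have "AE z in M. 0 \<le> f z"
    by eventually_elim (auto simp: f_def H_def S_def inner_commute split: split_indicator)
  ultimately have "AE z in M. f z = 0"
    by (simp add: integral_nonneg_eq_0_iff_AE)
  with data_M show ?thesis
  proof eventually_elim
    case (elim z)
    then show ?case
      by (cases "t < fst z \<bullet> v") (simp_all add: f_def H_def S_def inner_commute)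
  qed
qed

(* The complement of a closed convex set is covered by countably many open halfspaces
  disjoint from it (separation plus Lindelof). *)
lemma autoencoder_AE_closure_convex_hull:
  assumes data: "AE x in p. g x \<in> S"
  shows "AE z in M. fst z \<in> closure (convex hull S)"
proof -
  define C where "C = closure (convex hull S)"
  define \<F> where "\<F> = {{x. a \<bullet> x < b} | a b. \<forall>x\<in>C. b < a \<bullet> x}"
  have "open U" if "U \<in> \<F>" for U
    using that unfolding \<F>_def by (auto intro!: open_Collect_less continuous_intros)
  then obtain \<F>' where \<F>': "\<F>' \<subseteq> \<F>" "countable \<F>'" "\<Union>\<F>' = \<Union>\<F>"
    using Lindelof by blast
  have "\<Union>\<F> = - C"
  proof
    show "- C \<subseteq> \<Union>\<F>"
    proof
      fix y assume "y \<in> - C"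
      then obtain a b where "a \<bullet> y < b" "\<forall>x\<in>C. b < a \<bullet> x"
        using separating_hyperplane_closed_point[of C y] unfolding C_def
        by (auto intro: convex_closure)
      then show "y \<in> \<Union>\<F>"
        unfolding \<F>_def by blast
    qed
  qed (force simp: \<F>_def)
  have "AE z in M. fst z \<notin> U" if "U \<in> \<F>'" for U
  proof -
    obtain a b where U: "U = {x. a \<bullet> x < b}" and C: "\<forall>x\<in>C. b < a \<bullet> x"
      using \<open>U \<in> \<F>'\<close> \<F>'(1) unfolding \<F>_def by blast
    have "S \<subseteq> C"
      unfolding C_def by (meson closure_subset hull_subset subset_trans)
    have "AE x in p. g x \<bullet> (- a) \<le> - b"
      using data by eventually_elim (use \<open>S \<subseteq> C\<close> C in \<open>force simp: inner_commute\<close>)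
    from autoencoder_AE_halfspace[OF this] show ?thesis
      by eventually_elim (auto simp: U inner_commute)
  qed
  then have "AE z in M. \<forall>U\<in>\<F>'. fst z \<notin> U"
    using \<F>'(2) by (simp add: AE_ball_countable)
  then show ?thesis
  proof eventually_elim
    case (elim z)
    then have "fst z \<notin> \<Union>\<F>"
      using \<F>'(3) by blast
    then show ?case
      using \<open>\<Union>\<F> = - C\<close> by (simp add: C_def)
  qed
qed

(* Jensen's inequality: a measurably selected active affine piece at the code is a bounded
  function of the code, so it can be tested against g(X) in place of a. *)
lemma autoencoder_integral_max_affine_le:
  "(\<integral>z. max_affine c V N (fst z) \<partial>M) \<le> (\<integral>z. max_affine c V N (g (snd z)) \<partial>M)"
proof -
  interpret prob_space M by (rule autoencoder_prob_space)
  obtain i where [measurable]: "i \<in> borel \<rightarrow>\<^sub>M count_space UNIV"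
    and i: "\<And>y. i y \<le> N" "\<And>y. max_affine c V N y = c (i y) + V (i y) \<bullet> y"
    using max_affine_argmax by blast
  have V_meas: "(\<lambda>a. V (i a)) \<in> borel_measurable borel"
    by measurable
  have V_bound: "norm (V (i a)) \<le> (\<Sum>n\<le>N. norm (V n))" for a
    using i(1) by (intro member_le_sum) auto
  have c_int: "integrable M (\<lambda>z. c (i (fst z)))"
  proof (rule integrable_const_bound)
    show "AE z in M. norm (c (i (fst z))) \<le> (\<Sum>n\<le>N. norm (c n))"
      using i(1) by (intro AE_I2 member_le_sum) auto
  qed measurable
  have V_fst_meas: "(\<lambda>z. V (i (fst z))) \<in> borel_measurable M"
    by measurable
  note int_code = integrable_inner_bounded_left[OF autoencoder_integrable_code V_fst_meas V_bound]
  note int_data = integrable_inner_bounded_left[OF autoencoder_integrable_data V_fst_meas V_bound]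
  have "(\<integral>z. max_affine c V N (fst z) \<partial>M) = (\<integral>z. c (i (fst z)) \<partial>M) + (\<integral>z. V (i (fst z)) \<bullet> fst z \<partial>M)"
    using c_int int_code by (simp add: i(2))
  also have "\<dots> = (\<integral>z. c (i (fst z)) \<partial>M) + (\<integral>z. V (i (fst z)) \<bullet> g (snd z) \<partial>M)"
    using autoencoder_integral_inner[OF V_meas V_bound] by simp
  also have "\<dots> = (\<integral>z. c (i (fst z)) + V (i (fst z)) \<bullet> g (snd z) \<partial>M)"
    using c_int int_data by simp
  also have "\<dots> \<le> (\<integral>z. max_affine c V N (g (snd z)) \<partial>M)"
    using c_int int_data max_affine_ge[OF i(1)]
    by (intro integral_mono integrable_max_affine[OF finite_measure_axioms]
        autoencoder_integrable_data) auto
  finally show ?thesis .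
qed

(* G need not be bounded, so the self-consistency is applied to its truncations. *)
lemma autoencoder_integral_le_tangent:
  assumes G[measurable]: "G \<in> borel_measurable borel"
    and f: "integrable M f" and W: "integrable M (\<lambda>z. W (fst z))"
    and tangent: "AE z in M. f z \<le> W (fst z) + G (fst z) \<bullet> (g (snd z) - fst z)"
  shows "integral\<^sup>L M f \<le> (\<integral>z. W (fst z) \<partial>M)"
proof -
  interpret prob_space M by (rule autoencoder_prob_space)
  have [measurable]: "f \<in> borel_measurable M" "(\<lambda>z. W (fst z)) \<in> borel_measurable M"
    using f W by auto
  define H where "H n a = (if norm (G a) \<le> real n then G a else 0)" for n :: nat and a
  have H_meas[measurable]: "H n \<in> borel_measurable borel" for n
    unfolding H_def by measurable
  have H_bound: "norm (H n a) \<le> real n" for n a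
    unfolding H_def by auto
  have H_fst_meas: "(\<lambda>z. H n (fst z)) \<in> borel_measurable M" for n
    by measurable
  have "integral\<^sup>L M (\<lambda>z. f z - W (fst z)) \<le> 0"
  proof (rule integral_nonpos_of_truncations)
    show "integrable M (\<lambda>z. f z - W (fst z))"
      using f W by auto
    show "(\<lambda>z. norm (G (fst z))) \<in> borel_measurable M"
      by measurable
    fix n
    note int_code = integrable_inner_bounded_left[OF autoencoder_integrable_code H_fst_meas H_bound]
    note int_data = integrable_inner_bounded_left[OF autoencoder_integrable_data H_fst_meas H_bound]
    have "(\<integral>z. (if norm (G (fst z)) \<le> real n then f z - W (fst z) else 0) \<partial>M)
        \<le> (\<integral>z. H n (fst z) \<bullet> g (snd z) - H n (fst z) \<bullet> fst z \<partial>M)"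
    proof (rule integral_mono_AE)
      show "integrable M (\<lambda>z. if norm (G (fst z)) \<le> real n then f z - W (fst z) else 0)"
      proof (rule Bochner_Integration.integrable_bound)
        show "integrable M (\<lambda>z. f z - W (fst z))"
          using f W by auto
      qed auto
      show "AE z in M. (if norm (G (fst z)) \<le> real n then f z - W (fst z) else 0)
          \<le> H n (fst z) \<bullet> g (snd z) - H n (fst z) \<bullet> fst z"
        using tangent by eventually_elim (auto simp: H_def inner_diff_right)
    qed (use int_code int_data in auto)
    also have "\<dots> = 0"
      using int_code int_data autoencoder_integral_inner[OF H_meas H_bound] by simp
    finally show "(\<integral>z. (if norm (G (fst z)) \<le> real n then f z - W (fst z) else 0) \<partial>M) \<le> 0" .
  qed
  then show ?thesis
    using f W by simp
qed

end

lemma autoencoder_distr_graph: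
  fixes p :: "'a::euclidean_space measure" and A g :: "'a \<Rightarrow> 'a"
  assumes "prob_space p" and p_sets: "sets p = sets borel"
    and A_meas[measurable]: "A \<in> borel_measurable borel" and g_int: "integrable p g"
    and cond_exp: "AE z in distr p borel (\<lambda>x. (A x, x)). \<forall>b\<in>Basis.
        real_cond_exp (distr p borel (\<lambda>x. (A x, x)))
          (vimage_algebra (space (distr p borel (\<lambda>x. (A x, x)))) fst borel)
          (\<lambda>z. g (snd z) \<bullet> b) z = fst z \<bullet> b"
  shows "autoencoder p g (distr p borel (\<lambda>x. (A x, x)))"
proof -
  have graph_meas: "(\<lambda>x. (A x, x)) \<in> p \<rightarrow>\<^sub>M borel"
    by (rule measurable_graph[OF p_sets A_meas])
  have g_meas: "g \<in> borel_measurable borel"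
    using g_int p_sets by (auto cong: measurable_cong_sets)
  have "distr (distr p borel (\<lambda>x. (A x, x))) borel snd = distr p borel (\<lambda>x. x)"
    by (subst distr_distr[OF measurable_snd_sets_borel graph_meas]) (simp_all add: comp_def)
  also have "\<dots> = p"
    using p_sets by (intro distr_id2) simp
  finally show ?thesis
    unfolding autoencoder_def
    using prob_space.prob_space_distr[OF assms(1) graph_meas] cond_exp g_int
      integrable_distr_eq[OF graph_meas measurable_compose[OF measurable_snd_sets_borel g_meas]]
    by simp
qed

lemma blinfun_apply_eq_inner:
  fixes D :: "'a::euclidean_space \<Rightarrow>\<^sub>L real"
  shows "D v = (\<Sum>b\<in>Basis. D b *\<^sub>R b) \<bullet> v"
proof -
  have "D v = D (\<Sum>b\<in>Basis. (v \<bullet> b) *\<^sub>R b)"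
    by (simp add: euclidean_representation)
  also have "\<dots> = (\<Sum>b\<in>Basis. (v \<bullet> b) * D b)"
    by (simp add: blinfun.sum_right blinfun.scaleR_right)
  also have "\<dots> = (\<Sum>b\<in>Basis. D b *\<^sub>R b) \<bullet> v"
    by (subst inner_commute) (simp add: inner_sum_right mult.commute)
  finally show ?thesis .
qed

lemma C3_continuous_gradient:
  fixes W :: "'a::euclidean_space \<Rightarrow> real"
  assumes "C3 W"
  obtains G where "continuous_on UNIV G" and "\<And>a. (W has_derivative (\<lambda>v. G a \<bullet> v)) (at a)"
proof -
  obtain D1 :: "'a \<Rightarrow> ('a \<Rightarrow>\<^sub>L real)" and D2 :: "'a \<Rightarrow> ('a \<Rightarrow>\<^sub>L ('a \<Rightarrow>\<^sub>L real))"
    where W_deriv: "\<And>a. (W has_derivative blinfun_apply (D1 a)) (at a)"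
      and D1_deriv: "\<And>a. (D1 has_derivative blinfun_apply (D2 a)) (at a)"
    using assms unfolding C3_def by blast
  have "continuous_on UNIV D1"
    using D1_deriv has_derivative_continuous continuous_at_imp_continuous_on by blast
  have gradient: "blinfun_apply (D1 a) = (\<lambda>v. (\<Sum>b\<in>Basis. D1 a b *\<^sub>R b) \<bullet> v)" for a
    using blinfun_apply_eq_inner by blast
  show ?thesis
  proof (rule that)
    show "continuous_on UNIV (\<lambda>a. \<Sum>b\<in>Basis. D1 a b *\<^sub>R b)"
      using \<open>continuous_on UNIV D1\<close> by (intro continuous_intros)
    show "(W has_derivative (\<lambda>v. (\<Sum>b\<in>Basis. D1 a b *\<^sub>R b) \<bullet> v)) (at a)" for a
      using W_deriv[of a] by (subst (asm) gradient)
  qed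
qed

definition tangent :: "('a::real_inner \<Rightarrow> real) \<Rightarrow> ('a \<Rightarrow> 'a) \<Rightarrow> 'a \<Rightarrow> 'a \<Rightarrow> real" where
  "tangent W G \<xi> y = W \<xi> + G \<xi> \<bullet> (y - \<xi>)"

lemma tangent_affine:
  "tangent W G \<xi> ((1 - t) *\<^sub>R x + t *\<^sub>R y) = (1 - t) * tangent W G \<xi> x + t * tangent W G \<xi> y"
  by (simp add: tangent_def algebra_simps)

lemma cost_eq_tangent:
  assumes "(W has_derivative (\<lambda>v. G a \<bullet> v)) (at a)"
  shows "cost W a b = W b - tangent W G a b"
  using frechet_derivative_at[OF assms, symmetric] by (simp add: cost_def tangent_def inner_diff_right)

lemma proj_set_iff_tangent:
  assumes "\<And>a. (W has_derivative (\<lambda>v. G a \<bullet> v)) (at a)"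
  shows "a \<in> proj_set W \<Xi> b \<longleftrightarrow> a \<in> \<Xi> \<and> (\<forall>\<xi>\<in>\<Xi>. tangent W G \<xi> b \<le> tangent W G a b)"
proof -
  have "cost W a' b = W b - tangent W G a' b" for a'
    using cost_eq_tangent assms by blast
  then show ?thesis
    unfolding proj_set_def by auto
qed

definition max_tangent :: "('a::real_inner \<Rightarrow> real) \<Rightarrow> ('a \<Rightarrow> 'a) \<Rightarrow> (nat \<Rightarrow> 'a) \<Rightarrow> nat \<Rightarrow> 'a \<Rightarrow> real" where
  "max_tangent W G d = max_affine (\<lambda>n. W (d n) - G (d n) \<bullet> d n) (\<lambda>n. G (d n))"

lemma max_tangent_ge: "n \<le> N \<Longrightarrow> tangent W G (d n) y \<le> max_tangent W G d N y"
  using max_affine_ge[of n N "\<lambda>n. W (d n) - G (d n) \<bullet> d n" "\<lambda>n. G (d n)" y]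
  by (simp add: max_tangent_def tangent_def inner_diff_right)

lemma max_tangent_le: "(\<And>n. n \<le> N \<Longrightarrow> tangent W G (d n) y \<le> B) \<Longrightarrow> max_tangent W G d N y \<le> B"
  unfolding max_tangent_def by (rule max_affine_le) (simp add: tangent_def inner_diff_right algebra_simps)

lemma maximal_tangent_sequence:
  fixes W :: "'a::euclidean_space \<Rightarrow> real"
  assumes W_deriv: "\<And>a. (W has_derivative (\<lambda>v. G a \<bullet> v)) (at a)"
    and G_cont: "continuous_on UNIV G"
    and max: "maximal W \<Xi> (convex hull Y)"
    and S: "S \<subseteq> Y" "S \<noteq> {}" "\<And>s. s \<in> S \<Longrightarrow> proj_set W \<Xi> s \<noteq> {}"
  obtains d :: "nat \<Rightarrow> 'a" where "range d \<subseteq> \<Xi>"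
    and "\<And>y e. y \<in> closure (convex hull S) \<Longrightarrow> 0 < e \<Longrightarrow> \<exists>n. W y - e < tangent W G (d n) y"
proof -
  have W_cont: "continuous_on UNIV W"
    using W_deriv has_derivative_continuous continuous_at_imp_continuous_on by blast
  have cost: "cost W \<xi> z = W z - tangent W G \<xi> z" for \<xi> z
    using cost_eq_tangent W_deriv by blast
  have sup: "\<exists>\<xi>\<in>\<Xi>. W y - e < tangent W G \<xi> y" if "y \<in> closure (convex hull S)" "0 < e" for y e
  proof (rule le_sup_affine_family_closure_convex_hull[OF tangent_affine W_cont _ _ that])
    show "bdd_above ((\<lambda>\<xi>. tangent W G \<xi> s) ` \<Xi>)" if s: "s \<in> S" for s
    proof -
      obtain a where "a \<in> proj_set W \<Xi> s"
        using S(3)[OF s] by blast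
      then show ?thesis
        unfolding proj_set_iff_tangent[OF W_deriv] by (auto intro: bdd_aboveI2)
    qed
    show "\<exists>\<xi>\<in>\<Xi>. W z - e < tangent W G \<xi> z" if z: "z \<in> convex hull S" and "0 < e" for z e
    proof -
      have "z \<in> convex hull Y"
        using z hull_mono[OF S(1)] by blast
      then have "(INF \<xi>\<in>\<Xi>. ereal (cost W \<xi> z)) < ereal e"
        using max \<open>0 < e\<close> unfolding maximal_def by (meson ereal_less(2) order.strict_trans1)
      then show ?thesis
        by (force simp: INF_less_iff cost)
    qed
  qed
  have Xi_nonempty: "\<Xi> \<noteq> {}"
    using S(2,3) by (auto simp: proj_set_def)
  have tangent_cont: "continuous_on UNIV (\<lambda>\<xi>. tangent W G \<xi> y)" for y
    unfolding tangent_def by (intro continuous_intros W_cont G_cont)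
  obtain d :: "nat \<Rightarrow> 'a" where d: "range d \<subseteq> \<Xi>"
    "\<And>\<xi> y r. \<xi> \<in> \<Xi> \<Longrightarrow> r < tangent W G \<xi> y \<Longrightarrow> \<exists>n. r < tangent W G (d n) y"
    using dense_sequence_sup[where l = "tangent W G", OF Xi_nonempty tangent_cont] by blast
  show ?thesis
  proof (rule that[OF d(1)])
    fix y and e :: real
    assume "y \<in> closure (convex hull S)" "0 < e"
    then obtain \<xi> where "\<xi> \<in> \<Xi>" "W y - e < tangent W G \<xi> y"
      using sup by blast
    then show "\<exists>n. W y - e < tangent W G (d n) y"
      by (rule d(2))
  qed
qed

lemma autoencoder_integral_max_tangent_le:
  fixes W :: "'a::euclidean_space \<Rightarrow> real" and G :: "'a \<Rightarrow> 'a"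
  assumes W_deriv: "\<And>a. (W has_derivative (\<lambda>v. G a \<bullet> v)) (at a)"
    and G_meas[measurable]: "G \<in> borel_measurable borel"
    and g_meas[measurable]: "g \<in> borel_measurable borel"
    and M: "autoencoder p g M"
    and \<gamma>: "autoencoder p g \<gamma>" and \<gamma>_proj: "AE z in \<gamma>. fst z \<in> proj_set W \<Xi> (g (snd z))"
    and \<gamma>_int: "integrable \<gamma> (\<lambda>z. W (fst z))"
    and d: "range d \<subseteq> \<Xi>"
  shows "(\<integral>z. max_tangent W G d N (fst z) \<partial>M) \<le> (\<integral>z. W (fst z) \<partial>\<gamma>)"
proof -
  interpret \<gamma>: prob_space \<gamma> by (rule autoencoder_prob_space[OF \<gamma>])
  have "(\<integral>z. max_tangent W G d N (fst z) \<partial>M) \<le> (\<integral>z. max_tangent W G d N (g (snd z)) \<partial>M)"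
    unfolding max_tangent_def by (rule autoencoder_integral_max_affine_le[OF M])
  also have "\<dots> = (\<integral>x. max_tangent W G d N (g x) \<partial>p)"
    unfolding max_tangent_def by (rule autoencoder_integral_data[OF M]) measurable
  also have "\<dots> = (\<integral>z. max_tangent W G d N (g (snd z)) \<partial>\<gamma>)"
    unfolding max_tangent_def by (rule autoencoder_integral_data[OF \<gamma>, symmetric]) measurable
  also have "\<dots> \<le> (\<integral>z. W (fst z) \<partial>\<gamma>)"
  proof (rule autoencoder_integral_le_tangent[OF \<gamma> G_meas _ \<gamma>_int])
    show "integrable \<gamma> (\<lambda>z. max_tangent W G d N (g (snd z)))"
      unfolding max_tangent_def
      by (intro integrable_max_affine \<gamma>.finite_measure_axioms autoencoder_integrable_data[OF \<gamma>])
    show "AE z in \<gamma>. max_tangent W G d N (g (snd z)) \<le> W (fst z) + G (fst z) \<bullet> (g (snd z) - fst z)"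
      using \<gamma>_proj
    proof eventually_elim
      case (elim z)
      then have "tangent W G (d n) (g (snd z)) \<le> tangent W G (fst z) (g (snd z))" for n
        using d by (auto simp: proj_set_iff_tangent[OF W_deriv])
      then show ?case
        by (intro max_tangent_le) (simp add: tangent_def)
    qed
  qed
  finally show ?thesis .
qed

lemma autoencoder_integral_le_of_projection:
  fixes W :: "'a::euclidean_space \<Rightarrow> real" and G :: "'a \<Rightarrow> 'a"
  assumes W_deriv: "\<And>a. (W has_derivative (\<lambda>v. G a \<bullet> v)) (at a)"
    and G_cont: "continuous_on UNIV G"
    and max: "maximal W \<Xi> (convex hull (g ` \<X>))"
    and g_meas: "g \<in> borel_measurable borel"
    and data: "AE x in p. x \<in> \<X> \<and> proj_set W \<Xi> (g x) \<noteq> {}"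
    and \<gamma>: "autoencoder p g \<gamma>" and \<gamma>_proj: "AE z in \<gamma>. fst z \<in> proj_set W \<Xi> (g (snd z))"
    and \<gamma>_int: "integrable \<gamma> (\<lambda>z. W (fst z))"
    and M: "autoencoder p g M" and M_int: "integrable M (\<lambda>z. W (fst z))"
  shows "(\<integral>z. W (fst z) \<partial>M) \<le> (\<integral>z. W (fst z) \<partial>\<gamma>)"
proof -
  interpret \<gamma>: prob_space \<gamma> by (rule autoencoder_prob_space[OF \<gamma>])
  interpret M: prob_space M by (rule autoencoder_prob_space[OF M])
  define S where "S = {b \<in> g ` \<X>. proj_set W \<Xi> b \<noteq> {}}"
  have S_data: "AE x in p. g x \<in> S"
    using data by eventually_elim (auto simp: S_def)
  have "S \<noteq> {}"
    using autoencoder_AE_data[OF \<gamma> S_data] \<gamma>.AE_False by auto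
  moreover have "S \<subseteq> g ` \<X>" and "\<And>s. s \<in> S \<Longrightarrow> proj_set W \<Xi> s \<noteq> {}"
    unfolding S_def by auto
  ultimately obtain d :: "nat \<Rightarrow> 'a" where d: "range d \<subseteq> \<Xi>"
    "\<And>y e. y \<in> closure (convex hull S) \<Longrightarrow> 0 < e \<Longrightarrow> \<exists>n. W y - e < tangent W G (d n) y"
    using maximal_tangent_sequence[OF W_deriv G_cont max] by blast
  have above: "AE z in M. \<forall>e>0. \<forall>\<^sub>F N in sequentially. W (fst z) - e < max_tangent W G d N (fst z)"
    using autoencoder_AE_closure_convex_hull[OF M S_data]
  proof eventually_elim
    case (elim z)
    show ?case
    proof (intro allI impI)
      fix e :: real assume "0 < e"
      then obtain n where "W (fst z) - e < tangent W G (d n) (fst z)"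
        using d(2)[OF elim] by blast
      then show "\<forall>\<^sub>F N in sequentially. W (fst z) - e < max_tangent W G d N (fst z)"
        unfolding eventually_sequentially using max_tangent_ge by (blast intro: less_le_trans)
    qed
  qed
  have G_meas: "G \<in> borel_measurable borel"
    using G_cont by (rule borel_measurable_continuous_onI)
  show ?thesis
  proof (rule integral_le_of_AE_liminf_above[OF M_int _ _ above])
    show "integrable M (\<lambda>z. max_tangent W G d N (fst z))" for N
      unfolding max_tangent_def
      by (intro integrable_max_affine M.finite_measure_axioms autoencoder_integrable_code[OF M])
    show "max_tangent W G d 0 (fst z) \<le> max_tangent W G d N (fst z)" for N z
      using max_tangent_ge[of 0 N W G d] by (simp add: max_tangent_def tangent_def algebra_simps)
    show "(\<integral>z. max_tangent W G d N (fst z) \<partial>M) \<le> (\<integral>z. W (fst z) \<partial>\<gamma>)" for N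
      by (rule autoencoder_integral_max_tangent_le[OF W_deriv G_meas g_meas M \<gamma> \<gamma>_proj \<gamma>_int d(1)])
  qed
qed

theorem theorem7:
  fixes \<X> :: "'a::euclidean_space set" and p :: "'a measure"
    and g :: "'a \<Rightarrow> 'a" and W :: "'a \<Rightarrow> real"
    and \<Xi> :: "'a set" and A :: "'a \<Rightarrow> 'a"
  assumes X_borel: "\<X> \<in> sets borel"
    and p_prob: "prob_space p" and p_sets: "sets p = sets borel"
    and p_on_X: "AE x in p. x \<in> \<X>"
    and p_density: "\<exists>f \<in> borel_measurable lborel. p = density lborel f"
    and g_borel: "g \<in> borel_measurable borel"
    and g_int: "integrable p g"
    and W_C3: "C3 W"
    and Xi_max: "maximal W \<Xi> (convex hull (g ` \<X>))"
    and A_borel: "A \<in> borel_measurable borel"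
    and WA_int: "integrable p (\<lambda>x. W (A x))"
    and A_proj: "AE z in distr p borel (\<lambda>x. (A x, x)). fst z \<in> proj_set W \<Xi> (g (snd z))"
    and A_selfcons: "AE z in distr p borel (\<lambda>x. (A x, x)). \<forall>b\<in>Basis.
        real_cond_exp (distr p borel (\<lambda>x. (A x, x)))
          (vimage_algebra (space (distr p borel (\<lambda>x. (A x, x)))) fst borel)
          (\<lambda>z. g (snd z) \<bullet> b) z = fst z \<bullet> b"
  shows "optimal_autoencoder p g W (distr p borel (\<lambda>x. (A x, x)))"
proof -
  obtain G where G_cont: "continuous_on UNIV G" and W_deriv: "\<And>a. (W has_derivative (\<lambda>v. G a \<bullet> v)) (at a)"
    using C3_continuous_gradient[OF W_C3] by blast
  have "continuous_on UNIV W"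
    using W_deriv has_derivative_continuous continuous_at_imp_continuous_on by blast
  then have W_meas: "W \<in> borel_measurable borel"
    by (rule borel_measurable_continuous_onI)
  let ?\<gamma> = "distr p borel (\<lambda>x. (A x, x))"
  have graph_meas: "(\<lambda>x. (A x, x)) \<in> p \<rightarrow>\<^sub>M borel"
    by (rule measurable_graph[OF p_sets A_borel])
  have \<gamma>: "autoencoder p g ?\<gamma>"
    by (rule autoencoder_distr_graph[OF p_prob p_sets A_borel g_int A_selfcons])
  have \<gamma>_int: "integrable ?\<gamma> (\<lambda>z. W (fst z))"
    using WA_int integrable_distr_eq[OF graph_meas measurable_compose[OF measurable_fst_sets_borel W_meas]]
    by simp
  have "AE x in p. x \<in> \<X> \<and> proj_set W \<Xi> (g x) \<noteq> {}"
    using p_on_X AE_distrD[OF graph_meas A_proj] by eventually_elim auto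
  then show ?thesis
    unfolding optimal_autoencoder_def
    using \<gamma> \<gamma>_int autoencoder_integral_le_of_projection[OF W_deriv G_cont Xi_max g_borel _ \<gamma> A_proj \<gamma>_int]
    by blast
qed

end
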